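(* Let $n>2$ be an integer, let $G=\mathrm{Dc}_n$, and let $\varphi=\varphi_{(r,s)}\in\mathrm{Aut}(G)$ with $r\in\mathcal{U}_{2n}$ and $s\in\mathbb{Z}_{2n}$. Let $Q=\{g\varphi(g)^{-1}\mid g\in G\}$ and $H=\{g\in G\mid\varphi(g)=g\}$, and let $G$ (and hence $H$) act on $Q$ by $\varphi$-twisted conjugation $g*q=gq\varphi(g)^{-1}$. (1) If $s\notin\langle 1-r\rangle$, then the set of $H$-orbits in $Q$ is $$H\backslash Q=\big\{\{x^j\}\mid j\in\langle 1-r\rangle\cup(s+\langle r-1\rangle)\big\}=\big\{\{x^j\}\mid x^j\in Q\big\}.$$ (2) If $s\in\langle 1-r\rangle$, then the set of $H$-orbits in $Q$ is $$H\backslash Q=\big\{\{x^j,x^{-j}\}\mid j\in\langle 1-r\rangle\cup(s+\langle r-1\rangle)\big\}=\big\{\{x^j,x^{-j}\}\mid x^j\in Q\big\}.$$ In each case there is a single $G$-orbit in $Q$, so $G\backslash Q=\{Q\}$.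
   Context: $\mathrm{Dc}_n=\langle x,y \mid x^{2n}=1,\ y^2=x^n,\ y^{-1}xy=x^{-1}\rangle$ is the dicyclic group of order $4n$. $\mathcal{U}_{2n}$ denotes the set of units of $\mathbb{Z}_{2n}$ (integers modulo $2n$). For $n>2$, every automorphism of $\mathrm{Dc}_n$ can be written uniquely as $\varphi_{(r,s)}$ with $r\in\mathcal{U}_{2n}$, $s\in\mathbb{Z}_{2n}$, where $\varphi_{(r,s)}(x)=x^r$ and $\varphi_{(r,s)}(y)=yx^s$. For $a\in\mathbb{Z}_{2n}$, $\langle a\rangle$ denotes the additive subgroup of $\mathbb{Z}_{2n}$ generated by $a$, and $s+\langle a\rangle$ is its coset. $H\backslash Q$ and $G\backslash Q$ denote the sets of orbits of $H$ and $G$ on $Q$ under the $\varphi$-twisted action. *)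

theory Defs
  imports "HOL-Number_Theory.Residues" "HOL-Algebra.Generated_Groups" "HOL-Algebra.Group_Action"
begin

section \<open>Groups given by a presentation\<close>

text \<open>
  A letter \<open>(g, True)\<close> stands for the generator \<open>g\<close>, and \<open>(g, False)\<close> for its formal inverse.
  The generators are all elements of the type \<open>'g\<close>. A pair \<open>(u, v)\<close> in a set of relations stands
  for the relation \<open>u = v\<close>.
\<close>

type_synonym 'g word = "('g \<times> bool) list"

inductive pres_eq :: "('g word \<times> 'g word) set \<Rightarrow> 'g word \<Rightarrow> 'g word \<Rightarrow> bool"
  for R :: "('g word \<times> 'g word) set" where
  refl: "pres_eq R u u"
| sym: "pres_eq R u v \<Longrightarrow> pres_eq R v u"
| trans: "pres_eq R u v \<Longrightarrow> pres_eq R v w \<Longrightarrow> pres_eq R u w"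
| append: "pres_eq R u u' \<Longrightarrow> pres_eq R v v' \<Longrightarrow> pres_eq R (u @ v) (u' @ v')"
| cancel: "pres_eq R [(g, b), (g, \<not> b)] []"
| rel: "(u, v) \<in> R \<Longrightarrow> pres_eq R u v"

definition pres_class :: "('g word \<times> 'g word) set \<Rightarrow> 'g word \<Rightarrow> 'g word set" where
  "pres_class R u = {v. pres_eq R u v}"

definition presented_group :: "('g word \<times> 'g word) set \<Rightarrow> 'g word set monoid" where
  "presented_group R =
     \<lparr>carrier = range (pres_class R),
      monoid.mult = (\<lambda>A B. \<Union>u\<in>A. \<Union>v\<in>B. pres_class R (u @ v)),
      one = pres_class R []\<rparr>"

lemma pres_class_eq_iff: "pres_class R u = pres_class R v \<longleftrightarrow> pres_eq R u v"
proof
  assume "pres_class R u = pres_class R v"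
  then have "v \<in> pres_class R u" by (simp add: pres_class_def pres_eq.refl)
  then show "pres_eq R u v" by (simp add: pres_class_def)
next
  assume uv: "pres_eq R u v"
  show "pres_class R u = pres_class R v"
    unfolding pres_class_def
    using pres_eq.trans[OF uv] pres_eq.trans[OF pres_eq.sym[OF uv]] by (intro Collect_cong iffI)
qed

lemma mult_pres_class:
  "pres_class R u \<otimes>\<^bsub>presented_group R\<^esub> pres_class R v = pres_class R (u @ v)"
proof -
  have "pres_class R (u' @ v') = pres_class R (u @ v)"
    if "u' \<in> pres_class R u" "v' \<in> pres_class R v" for u' v'
    unfolding pres_class_eq_iff
    by (rule pres_eq.sym, rule pres_eq.append) (use that in \<open>simp_all add: pres_class_def\<close>)
  then have "(\<Union>u'\<in>pres_class R u. \<Union>v'\<in>pres_class R v. pres_class R (u' @ v')) =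
      (\<Union>u'\<in>pres_class R u. \<Union>v'\<in>pres_class R v. pres_class R (u @ v))"
    by simp
  moreover have "pres_class R u \<noteq> {}" "pres_class R v \<noteq> {}"
    using pres_eq.refl by (auto simp only: pres_class_def)
  ultimately show ?thesis
    by (simp add: presented_group_def)
qed

lemma pres_eq_inverse: "pres_eq R (map (\<lambda>(g, b). (g, \<not> b)) (rev w) @ w) []"
proof (induction w)
  case Nil
  show ?case by (simp add: pres_eq.refl)
next
  case (Cons a w)
  obtain g b where a: "a = (g, b)" by fastforce
  let ?i = "map (\<lambda>(g, b). (g, \<not> b)) (rev w)"
  have "pres_eq R ([(g, \<not> b), (g, b)] @ w) ([] @ w)"
    using pres_eq.append[OF pres_eq.cancel[of R g "\<not> b"] pres_eq.refl[of R w]] by simp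
  then have "pres_eq R (?i @ ([(g, \<not> b), (g, b)] @ w)) (?i @ ([] @ w))"
    by (rule pres_eq.append[OF pres_eq.refl])
  then have "pres_eq R (?i @ ([(g, \<not> b), (g, b)] @ w)) (?i @ w)"
    by (simp only: append_Nil)
  then have "pres_eq R (?i @ ([(g, \<not> b), (g, b)] @ w)) []"
    using Cons.IH by (rule pres_eq.trans)
  then show ?case by (simp add: a)
qed

lemma group_presented_group: "group (presented_group R)"
proof (rule groupI)
  fix A B assume "A \<in> carrier (presented_group R)" "B \<in> carrier (presented_group R)"
  then obtain u v where "A = pres_class R u" "B = pres_class R v"
    by (auto simp: presented_group_def)
  then show "A \<otimes>\<^bsub>presented_group R\<^esub> B \<in> carrier (presented_group R)"
    by (simp add: mult_pres_class) (simp add: presented_group_def)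
next
  show "\<one>\<^bsub>presented_group R\<^esub> \<in> carrier (presented_group R)"
    by (simp add: presented_group_def)
next
  fix A B C
  assume "A \<in> carrier (presented_group R)" "B \<in> carrier (presented_group R)"
    "C \<in> carrier (presented_group R)"
  then obtain u v w where "A = pres_class R u" "B = pres_class R v" "C = pres_class R w"
    by (auto simp: presented_group_def)
  then show "A \<otimes>\<^bsub>presented_group R\<^esub> B \<otimes>\<^bsub>presented_group R\<^esub> C =
      A \<otimes>\<^bsub>presented_group R\<^esub> (B \<otimes>\<^bsub>presented_group R\<^esub> C)"
    by (simp add: mult_pres_class)
next
  fix A assume "A \<in> carrier (presented_group R)"
  then obtain u where u: "A = pres_class R u"
    by (auto simp: presented_group_def)
  have one: "\<one>\<^bsub>presented_group R\<^esub> = pres_class R []"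
    by (simp add: presented_group_def)
  show "\<one>\<^bsub>presented_group R\<^esub> \<otimes>\<^bsub>presented_group R\<^esub> A = A"
    by (simp add: u one mult_pres_class)
  have "pres_class R (map (\<lambda>(g, b). (g, \<not> b)) (rev u)) \<otimes>\<^bsub>presented_group R\<^esub> A =
      \<one>\<^bsub>presented_group R\<^esub>"
    by (simp add: u one mult_pres_class pres_class_eq_iff pres_eq_inverse)
  then show "\<exists>B\<in>carrier (presented_group R).
      B \<otimes>\<^bsub>presented_group R\<^esub> A = \<one>\<^bsub>presented_group R\<^esub>"
    by (auto simp: presented_group_def)
qed

section \<open>Dicyclic groups\<close>

datatype dic_gen = X | Y

definition dic_rels :: "nat \<Rightarrow> (dic_gen word \<times> dic_gen word) set" where
  "dic_rels n =
     {(replicate (2 * n) (X, True), []),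
      ([(Y, True), (Y, True)], replicate n (X, True)),
      ([(Y, False), (X, True), (Y, True)], [(X, False)])}"

definition Dc :: "nat \<Rightarrow> dic_gen word set monoid" where
  "Dc n = presented_group (dic_rels n)"

definition dic_x :: "nat \<Rightarrow> dic_gen word set" where
  "dic_x n = pres_class (dic_rels n) [(X, True)]"

definition dic_y :: "nat \<Rightarrow> dic_gen word set" where
  "dic_y n = pres_class (dic_rels n) [(Y, True)]"

section \<open>Integers modulo \<open>2n\<close>\<close>

text \<open>The ring has carrier \<open>{0..2n-1}\<close>, so its elements can serve directly as exponents.\<close>

abbreviation Z2 :: "nat \<Rightarrow> int ring" where
  "Z2 n \<equiv> residue_ring (2 * int n)"

definition add_gen :: "nat \<Rightarrow> int \<Rightarrow> int set" where
  "add_gen n a = generate (add_monoid (Z2 n)) {a}"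

section \<open>Twisted conjugation\<close>

definition twisted_Q :: "('a, 'b) monoid_scheme \<Rightarrow> ('a \<Rightarrow> 'a) \<Rightarrow> 'a set" where
  "twisted_Q G \<phi> = {g \<otimes>\<^bsub>G\<^esub> inv\<^bsub>G\<^esub> (\<phi> g) | g. g \<in> carrier G}"

definition fixed_points :: "('a, 'b) monoid_scheme \<Rightarrow> ('a \<Rightarrow> 'a) \<Rightarrow> 'a set" where
  "fixed_points G \<phi> = {g \<in> carrier G. \<phi> g = g}"

text \<open>Restricted to \<open>Q\<close>, because \<^const>\<open>Bij\<close> consists of extensional functions.\<close>

definition twisted_conj :: "('a, 'b) monoid_scheme \<Rightarrow> ('a \<Rightarrow> 'a) \<Rightarrow> 'a \<Rightarrow> 'a \<Rightarrow> 'a" where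
  "twisted_conj G \<phi> g = (\<lambda>q\<in>twisted_Q G \<phi>. g \<otimes>\<^bsub>G\<^esub> q \<otimes>\<^bsub>G\<^esub> inv\<^bsub>G\<^esub> (\<phi> g))"

definition twisted_orbits ::
    "('a, 'b) monoid_scheme \<Rightarrow> ('a \<Rightarrow> 'a) \<Rightarrow> 'a set \<Rightarrow> 'a set set" where
  "twisted_orbits G \<phi> K = orbits (G\<lparr>carrier := K\<rparr>) (twisted_Q G \<phi>) (twisted_conj G \<phi>)"

lemma group_action_twisted_conj:
  fixes G (structure)
  assumes "group G" and \<phi>: "\<phi> \<in> hom G G"
  shows "group_action G (twisted_Q G \<phi>) (twisted_conj G \<phi>)"
proof -
  interpret group G by fact
  interpret h: group_hom G G \<phi>
    using \<phi> by (simp add: group_hom_def group_hom_axioms_def is_group)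
  let ?Q = "twisted_Q G \<phi>" and ?T = "twisted_conj G \<phi>"
  have Qc: "q \<in> carrier G" if "q \<in> ?Q" for q
    using that by (auto simp: twisted_Q_def)
  have closed: "?T g q \<in> ?Q" if g: "g \<in> carrier G" and q: "q \<in> ?Q" for g q
  proof -
    obtain k where k: "k \<in> carrier G" "q = k \<otimes> inv (\<phi> k)"
      using q by (auto simp: twisted_Q_def)
    have "?T g q = (g \<otimes> k) \<otimes> inv (\<phi> (g \<otimes> k))"
      using g q k by (simp add: twisted_conj_def m_assoc inv_mult_group)
    then show ?thesis using g k unfolding twisted_Q_def by blast
  qed
  have comp: "?T (g \<otimes> k) q = ?T g (?T k q)"
    if "g \<in> carrier G" "k \<in> carrier G" "q \<in> ?Q" for g k q
    using that closed[of k q] Qc[of q]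
    by (simp add: twisted_conj_def m_assoc inv_mult_group)
  have one: "?T \<one> q = q" if "q \<in> ?Q" for q
    using that Qc[of q] by (simp add: twisted_conj_def)
  have bij: "?T g \<in> Bij ?Q" if g: "g \<in> carrier G" for g
  proof -
    have "bij_betw (?T g) ?Q ?Q"
      by (rule bij_betw_byWitness[where f' = "?T (inv g)"])
        (use g closed comp[symmetric] one in auto)
    moreover have "?T g \<in> extensional ?Q"
      by (simp add: twisted_conj_def)
    ultimately show ?thesis by (simp add: Bij_def)
  qed
  have "?T (g \<otimes> k) = compose ?Q (?T g) (?T k)"
    if "g \<in> carrier G" "k \<in> carrier G" for g k
    by (rule extensionalityI[where A = ?Q])
      (use that comp in \<open>auto simp: twisted_conj_def compose_def\<close>)
  then have "?T \<in> hom G (BijGroup ?Q)"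
    using bij by (auto simp: hom_def BijGroup_def)
  then show ?thesis
    unfolding group_action_def
    by (simp add: group_hom_def group_hom_axioms_def is_group group_BijGroup)
qed

end

theory Submission
  imports Defs "HOL-Algebra.Elementary_Groups"
begin

text \<open>
  Every element of the dicyclic group is \<open>x\<^sup>i\<close> or \<open>y x\<^sup>i\<close>, and \<open>y\<close> inverts the powers of \<open>x\<close>.
  Writing \<open>g \<phi>(g)\<^sup>-\<^sup>1\<close> out for the two shapes gives \<open>x\<close> to the power \<open>i (1 - r)\<close> and
  \<open>s + i (r - 1)\<close> respectively, so \<open>Q\<close> consists of powers of \<open>x\<close> (\<open>twisted_Q_eq\<close>).

  A fixed point of \<open>\<phi>\<close> acts on \<open>Q\<close> by ordinary conjugation. The fixed points of shape \<open>x\<^sup>i\<close>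
  commute with \<open>Q\<close>; those of shape \<open>y x\<^sup>i\<close> invert it. Hence the \<open>H\<close>-orbits are the
  sets \<open>{q}\<close>, or the sets \<open>{q, q\<^sup>-\<^sup>1}\<close>, according to whether a fixed point of the second shape is
  absent or present. Now \<open>y x\<^sup>i\<close> is fixed iff \<open>x\<close> to the power \<open>s + i (r - 1)\<close> is trivial, that is, iff
  \<open>2n\<close> divides \<open>s + i (r - 1)\<close>, and some \<open>i\<close> achieves this iff \<open>s\<close> is a multiple of \<open>1 - r\<close>
  modulo \<open>2n\<close>.

  The one fact that the relations do not yield by calculation is that \<open>x\<close> has order exactly \<open>2n\<close>
  (\<open>dic_x_pow_eq_one_iff\<close>): collapse has to be excluded by exhibiting a model of the presentation.
  It is the action of the group on its own normal forms \<open>x\<^sup>i y\<^sup>b\<close> by left multiplication.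

  Finally, \<open>Q\<close> is the orbit of the identity under the twisted action of the whole group,
  so it is a single \<open>G\<close>-orbit for any group and any homomorphism.
\<close>

section \<open>Orbits of twisted conjugation\<close>

lemma twisted_orbits_eq_image:
  "twisted_orbits G \<phi> K =
     (\<lambda>q. (\<lambda>h. h \<otimes>\<^bsub>G\<^esub> q \<otimes>\<^bsub>G\<^esub> inv\<^bsub>G\<^esub> (\<phi> h)) ` K) ` twisted_Q G \<phi>"
  by (auto simp: twisted_orbits_def orbits_def orbit_def twisted_conj_def)

text \<open>
  For \<open>q = k \<phi>(k)\<^sup>-\<^sup>1\<close> one has \<open>g * q = (g k) \<phi>(g k)\<^sup>-\<^sup>1\<close>, and \<open>g k\<close> runs through the whole group
  along with \<open>g\<close>.
\<close>

lemma twisted_orbits_carrier: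
  fixes G (structure)
  assumes "group G" and \<phi>: "\<phi> \<in> hom G G"
  shows "twisted_orbits G \<phi> (carrier G) = {twisted_Q G \<phi>}"
proof -
  interpret group G by fact
  interpret h: group_hom G G \<phi>
    using \<phi> by (simp add: group_hom_def group_hom_axioms_def is_group)
  have orbit: "(\<lambda>g. g \<otimes> q \<otimes> inv (\<phi> g)) ` carrier G = twisted_Q G \<phi>" if q: "q \<in> twisted_Q G \<phi>" for q
  proof -
    obtain k where k: "k \<in> carrier G" "q = k \<otimes> inv (\<phi> k)"
      using q by (auto simp: twisted_Q_def)
    have "(\<lambda>g. g \<otimes> q \<otimes> inv (\<phi> g)) ` carrier G =
        (\<lambda>g. g \<otimes> inv (\<phi> g)) ` (\<lambda>g. g \<otimes> k) ` carrier G"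
      unfolding image_image
      by (rule image_cong) (use k in \<open>simp_all add: m_assoc inv_mult_group\<close>)
    also have "(\<lambda>g. g \<otimes> k) ` carrier G = carrier G"
    proof (intro equalityI subsetI)
      fix g assume "g \<in> carrier G"
      then show "g \<in> (\<lambda>g. g \<otimes> k) ` carrier G"
        by (intro image_eqI[of _ _ "g \<otimes> inv k"]) (use k in \<open>simp_all add: m_assoc\<close>)
    qed (use k in auto)
    finally show ?thesis by (auto simp: twisted_Q_def)
  qed
  have "twisted_Q G \<phi> \<noteq> {}" by (auto simp: twisted_Q_def)
  then show ?thesis unfolding twisted_orbits_eq_image by (auto simp: orbit)
qed

section \<open>Cyclic subgroups of the integers modulo \<open>2n\<close>\<close>

text \<open>
  Reducing multiples of \<open>a\<close> modulo \<open>2n\<close> is a homomorphism from the integers, so the \<open>i\<close>-th power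
  of \<open>a\<close> in the additive group is the residue of \<open>i a\<close>.
\<close>

lemma add_gen_mod:
  assumes "n > 0"
  shows "add_gen n (a mod (2 * int n)) = range (\<lambda>i. (i * a) mod (2 * int n))"
proof -
  interpret residues "2 * int n" "Z2 n"
    by unfold_locales (use assms in auto)
  interpret abelian_group "Z2 n" by (rule abelian_group)
  let ?h = "\<lambda>i. (i * a) mod (2 * int n)"
  have "?h \<in> hom integer_group (add_monoid (Z2 n))"
    using assms by (auto simp: hom_def residue_ring_def integer_group_def distrib_right mod_add_eq)
  from hom_int_pow[OF this _ group_integer_group add.is_group, of 1]
  have pow: "?h 1 [^]\<^bsub>add_monoid (Z2 n)\<^esub> i = ?h i" for i :: int
    by simp
  have "?h 1 \<in> carrier (add_monoid (Z2 n))"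
    using assms by (simp add: residue_ring_def)
  from group.generate_pow[OF a_group this] show ?thesis
    unfolding pow add_gen_def by auto
qed

lemma residue_ring_minus:
  assumes "n > 0" "a \<in> carrier (Z2 n)" "b \<in> carrier (Z2 n)"
  shows "a \<ominus>\<^bsub>Z2 n\<^esub> b = (a - b) mod (2 * int n)"
proof -
  interpret residues "2 * int n" "Z2 n"
    by unfold_locales (use assms in auto)
  show ?thesis
    by (simp add: a_minus_def res_neg_eq res_add_eq mod_simps)
qed

section \<open>Twisted conjugation on a group of dicyclic shape\<close>

text \<open>
  Axiomatizing the shape of the elements, the order of \<open>x\<close> and the conjugation rule turns the orbit
  computation into arithmetic with integer exponents, free of words and congruence classes.
\<close>

locale dicyclic_twist = group G for G (structure) +
  fixes \<phi> x y and n :: nat and r s :: int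
  assumes hom: "\<phi> \<in> hom G G"
    and x [simp, intro]: "x \<in> carrier G" and y [simp, intro]: "y \<in> carrier G"
    and pos: "n > 0"
    and x_pow_eq_one: "\<And>k::int. x [^] k = \<one> \<longleftrightarrow> 2 * int n dvd k"
    and y_conj: "inv y \<otimes> x \<otimes> y = inv x"
    and shape: "\<And>g. g \<in> carrier G \<Longrightarrow> \<exists>i::int. g = x [^] i \<or> g = y \<otimes> x [^] i"
    and \<phi>_x: "\<phi> x = x [^] r" and \<phi>_y: "\<phi> y = y \<otimes> x [^] s"
begin

sublocale h: group_hom G G \<phi>
  using hom by (simp add: group_hom_def group_hom_axioms_def is_group)

lemma x_pow_mod: "x [^] (k mod (2 * int n)) = x [^] k"
proof -
  have one: "x [^] (2 * int n * (k div (2 * int n))) = \<one>"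
    by (simp add: x_pow_eq_one)
  have "x [^] k = x [^] (2 * int n * (k div (2 * int n)) + k mod (2 * int n))"
    by simp
  also have "\<dots> = x [^] (2 * int n * (k div (2 * int n))) \<otimes> x [^] (k mod (2 * int n))"
    by (rule int_pow_mult[OF x])
  finally show ?thesis by (simp add: one)
qed

lemma y_inverts_x_pow: "y \<otimes> x [^] (i::int) \<otimes> inv y = x [^] (- i)"
proof -
  let ?c = "\<lambda>g. y \<otimes> g \<otimes> inv y"
  have "?c \<in> hom G G"
    by (auto simp: hom_def m_assoc inv_solve_left)
  moreover have "?c x = inv x"
  proof -
    have "x \<otimes> y = y \<otimes> inv x"
      using y_conj by (simp add: m_assoc inv_solve_left')
    then have "x \<otimes> y \<otimes> x = y"
      by (simp add: m_assoc)
    then have "y \<otimes> x = inv x \<otimes> y"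
      by (metis inv_solve_left m_assoc m_closed x y)
    then show ?thesis by (simp add: m_assoc)
  qed
  ultimately have "?c (x [^] i) = inv x [^] i"
    using hom_int_pow[of ?c G G x i] by simp
  then show ?thesis by (simp add: int_pow_inv int_pow_neg)
qed

lemma \<phi>_x_pow: "\<phi> (x [^] (i::int)) = x [^] (r * i)"
  by (simp add: h.hom_int_pow \<phi>_x int_pow_pow)

lemma \<phi>_y_x_pow: "\<phi> (y \<otimes> x [^] (i::int)) = y \<otimes> x [^] (s + r * i)"
  by (simp add: \<phi>_x_pow \<phi>_y m_assoc int_pow_mult)

text \<open>The union of \<open>\<langle>1 - r\<rangle>\<close> and \<open>s + \<langle>r - 1\<rangle>\<close>, with residues taken in \<open>{0..2n-1}\<close>.\<close>

definition exponents :: "int set" where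
  "exponents = range (\<lambda>i. (i * (1 - r)) mod (2 * int n)) \<union>
     range (\<lambda>i. (s + i * (r - 1)) mod (2 * int n))"

lemma twist_x_pow: "x [^] (i::int) \<otimes> inv (\<phi> (x [^] i)) = x [^] (i * (1 - r))"
  by (simp add: \<phi>_x_pow int_pow_neg[symmetric] int_pow_mult[symmetric] algebra_simps)

lemma twist_y_x_pow:
  "y \<otimes> x [^] (i::int) \<otimes> inv (\<phi> (y \<otimes> x [^] i)) = x [^] (s + i * (r - 1))"
proof -
  have "y \<otimes> x [^] i \<otimes> inv (\<phi> (y \<otimes> x [^] i)) = y \<otimes> (x [^] i \<otimes> x [^] (- (s + r * i))) \<otimes> inv y"
    unfolding \<phi>_y_x_pow by (simp add: inv_mult_group m_assoc int_pow_neg del: minus_add_distrib)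
  also have "x [^] i \<otimes> x [^] (- (s + r * i)) = x [^] (i + - (s + r * i))"
    by (simp only: int_pow_mult x)
  also have "y \<otimes> \<dots> \<otimes> inv y = x [^] (s + i * (r - 1))"
    by (simp add: y_inverts_x_pow algebra_simps)
  finally show ?thesis .
qed

lemma twisted_Q_eq: "twisted_Q G \<phi> = (\<lambda>j. x [^] j) ` exponents"
proof
  show "twisted_Q G \<phi> \<subseteq> (\<lambda>j. x [^] j) ` exponents"
  proof
    fix q assume "q \<in> twisted_Q G \<phi>"
    then obtain g where g: "g \<in> carrier G" "q = g \<otimes> inv (\<phi> g)"
      by (auto simp: twisted_Q_def)
    from shape[OF g(1)] obtain i :: int where "g = x [^] i \<or> g = y \<otimes> x [^] i" by blast
    then have "q = x [^] (i * (1 - r)) \<or> q = x [^] (s + i * (r - 1))"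
      using g(2) twist_x_pow twist_y_x_pow by auto
    then show "q \<in> (\<lambda>j. x [^] j) ` exponents"
      by (auto simp: exponents_def image_Un image_image x_pow_mod)
  qed
next
  show "(\<lambda>j. x [^] j) ` exponents \<subseteq> twisted_Q G \<phi>"
    unfolding exponents_def twisted_Q_def
    by (auto simp: x_pow_mod twist_x_pow[symmetric] twist_y_x_pow[symmetric] simp del: h.hom_mult)
qed

lemma exponents_in_carrier: "exponents \<subseteq> carrier (Z2 n)"
  using pos by (auto simp: exponents_def residue_ring_def)

lemma x_pow_image_carrier:
  "(\<lambda>j. x [^] j) ` {j \<in> carrier (Z2 n). x [^] j \<in> twisted_Q G \<phi>} = twisted_Q G \<phi>"
  using exponents_in_carrier by (auto simp: twisted_Q_eq)

text \<open>
  A group element is fixed iff its twist \<open>g \<phi>(g)\<^sup>-\<^sup>1\<close> is trivial; for the shape \<open>y x\<^sup>i\<close> the order of \<open>x\<close>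
  turns this into a divisibility.
\<close>

lemma fixed_point_y_x_pow:
  "y \<otimes> x [^] (i::int) \<in> fixed_points G \<phi> \<longleftrightarrow> 2 * int n dvd s + i * (r - 1)"
proof -
  have "y \<otimes> x [^] i \<in> fixed_points G \<phi> \<longleftrightarrow> y \<otimes> x [^] i \<otimes> inv (\<phi> (y \<otimes> x [^] i)) = \<one>"
    by (auto simp: fixed_points_def inv_solve_right' simp del: h.hom_mult)
  then show ?thesis unfolding twist_y_x_pow x_pow_eq_one .
qed

text \<open>This is what separates the two cases of the theorem.\<close>

lemma multiple_of_one_minus_r_iff: "s \<in> range (\<lambda>i. (i * (1 - r)) mod (2 * int n)) \<longleftrightarrow>
    s \<in> carrier (Z2 n) \<and> (\<exists>i. y \<otimes> x [^] (i::int) \<in> fixed_points G \<phi>)"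
proof -
  have "s = (i * (1 - r)) mod (2 * int n) \<longleftrightarrow>
      s \<in> carrier (Z2 n) \<and> 2 * int n dvd s + i * (r - 1)" for i
  proof -
    have "s = (i * (1 - r)) mod (2 * int n) \<longleftrightarrow>
        s mod (2 * int n) = s \<and> s mod (2 * int n) = (i * (1 - r)) mod (2 * int n)"
      by auto
    also have "s mod (2 * int n) = s \<longleftrightarrow> s \<in> carrier (Z2 n)"
      using pos by (auto simp: residue_ring_def zmod_trivial_iff)
    also have "s mod (2 * int n) = (i * (1 - r)) mod (2 * int n) \<longleftrightarrow> 2 * int n dvd s + i * (r - 1)"
      by (simp add: mod_eq_dvd_iff algebra_simps)
    finally show ?thesis .
  qed
  then show ?thesis by (auto simp: fixed_point_y_x_pow)
qed

lemma fixed_conj_x_pow: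
  fixes i j :: int
  shows "x [^] i \<in> fixed_points G \<phi> \<Longrightarrow> x [^] i \<otimes> x [^] j \<otimes> inv (\<phi> (x [^] i)) = x [^] j"
    and "y \<otimes> x [^] i \<in> fixed_points G \<phi> \<Longrightarrow>
      y \<otimes> x [^] i \<otimes> x [^] j \<otimes> inv (\<phi> (y \<otimes> x [^] i)) = x [^] (- j)"
proof -
  have conj: "x [^] i \<otimes> x [^] j \<otimes> inv (x [^] i) = x [^] j"
    by (simp add: int_pow_neg[symmetric] int_pow_mult[symmetric])
  then show "x [^] i \<in> fixed_points G \<phi> \<Longrightarrow> x [^] i \<otimes> x [^] j \<otimes> inv (\<phi> (x [^] i)) = x [^] j"
    by (simp add: fixed_points_def)
  have "y \<otimes> x [^] i \<otimes> x [^] j \<otimes> inv (y \<otimes> x [^] i) =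
      y \<otimes> (x [^] i \<otimes> x [^] j \<otimes> inv (x [^] i)) \<otimes> inv y"
    by (simp add: inv_mult_group m_assoc)
  then have "y \<otimes> x [^] i \<otimes> x [^] j \<otimes> inv (y \<otimes> x [^] i) = x [^] (- j)"
    unfolding conj y_inverts_x_pow .
  then show "y \<otimes> x [^] i \<in> fixed_points G \<phi> \<Longrightarrow>
      y \<otimes> x [^] i \<otimes> x [^] j \<otimes> inv (\<phi> (y \<otimes> x [^] i)) = x [^] (- j)"
    by (simp add: fixed_points_def)
qed

text \<open>
  The identity is fixed, so \<open>x\<^sup>j\<close> lies in its own orbit, and by the preceding lemma the only
  other possible member is \<open>x\<^sup>-\<^sup>j\<close>, the image of \<open>x\<^sup>j\<close> under every fixed point \<open>y x\<^sup>i\<close>.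
\<close>

lemma fixed_orbit:
  "(\<lambda>h. h \<otimes> x [^] (j::int) \<otimes> inv (\<phi> h)) ` fixed_points G \<phi> =
     (if \<exists>i::int. y \<otimes> x [^] i \<in> fixed_points G \<phi> then {x [^] j, x [^] (- j)} else {x [^] j})"
    (is "?orbit = _")
proof -
  have "\<one> \<in> fixed_points G \<phi>" by (simp add: fixed_points_def)
  then have self: "x [^] j \<in> ?orbit"
    by (rule rev_image_eqI) simp
  have cases: "\<exists>i::int. h = x [^] i \<or> h = y \<otimes> x [^] i" if "h \<in> fixed_points G \<phi>" for h
    using that shape by (simp add: fixed_points_def)
  show ?thesis
  proof (cases "\<exists>i::int. y \<otimes> x [^] i \<in> fixed_points G \<phi>")
    case True
    then obtain i :: int where i: "y \<otimes> x [^] i \<in> fixed_points G \<phi>" by blast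
    have "x [^] (- j) \<in> ?orbit"
      by (rule rev_image_eqI[OF i]) (simp only: fixed_conj_x_pow(2)[OF i])
    moreover have "?orbit \<subseteq> {x [^] j, x [^] (- j)}"
      using cases fixed_conj_x_pow by blast
    ultimately show ?thesis using self True by auto
  next
    case False
    then have "?orbit \<subseteq> {x [^] j}"
      using cases fixed_conj_x_pow by blast
    then show ?thesis using self False by auto
  qed
qed

text \<open>
  Several sets of exponents describe \<open>Q\<close>, and the theorem uses two of them:
  the explicit residues, and all residues \<open>j\<close> with \<open>x\<^sup>j\<close> in \<open>Q\<close>.
\<close>

lemma twisted_orbits_fixed_points:
  fixes J :: "int set"
  assumes "(\<lambda>j. x [^] j) ` J = twisted_Q G \<phi>"
  shows "twisted_orbits G \<phi> (fixed_points G \<phi>) =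
    (if \<exists>i::int. y \<otimes> x [^] i \<in> fixed_points G \<phi> then {{x [^] j, x [^] (- j)} | j. j \<in> J}
     else {{x [^] j} | j. j \<in> J})"
  unfolding twisted_orbits_eq_image assms[symmetric] image_image fixed_orbit by auto

end

section \<open>The normal form and the order of \<open>x\<close> in the dicyclic group\<close>

interpretation Dc: group "Dc n" for n
  unfolding Dc_def by (rule group_presented_group)

lemma pres_class_in_Dc: "pres_class (dic_rels n) w \<in> carrier (Dc n)"
  by (simp add: Dc_def presented_group_def)

lemma Dc_mult_class: "pres_class (dic_rels n) u \<otimes>\<^bsub>Dc n\<^esub> pres_class (dic_rels n) v =
    pres_class (dic_rels n) (u @ v)"
  by (simp add: Dc_def mult_pres_class)

lemma Dc_one: "\<one>\<^bsub>Dc n\<^esub> = pres_class (dic_rels n) []"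
  by (simp add: Dc_def presented_group_def)

lemma dic_x_closed [simp]: "dic_x n \<in> carrier (Dc n)"
  and dic_y_closed [simp]: "dic_y n \<in> carrier (Dc n)"
  by (simp_all add: dic_x_def dic_y_def pres_class_in_Dc)

lemma Dc_inv_letter:
  "inv\<^bsub>Dc n\<^esub> (pres_class (dic_rels n) [(g, True)]) = pres_class (dic_rels n) [(g, False)]"
proof (rule Dc.inv_equality)
  show "pres_class (dic_rels n) [(g, False)] \<otimes>\<^bsub>Dc n\<^esub> pres_class (dic_rels n) [(g, True)] = \<one>\<^bsub>Dc n\<^esub>"
    using pres_eq.cancel[of "dic_rels n" g False]
    by (simp add: Dc_mult_class Dc_one pres_class_eq_iff)
qed (simp_all add: pres_class_in_Dc)

lemma dic_x_pow_nat: "dic_x n [^]\<^bsub>Dc n\<^esub> (k::nat) = pres_class (dic_rels n) (replicate k (X, True))"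
proof (induction k)
  case (Suc k)
  then show ?case
    by (simp add: dic_x_def Dc_mult_class replicate_append_same)
qed (simp add: Dc_one)

lemma dic_x_pow_order: "dic_x n [^]\<^bsub>Dc n\<^esub> (2 * n) = \<one>\<^bsub>Dc n\<^esub>"
  by (simp add: dic_x_pow_nat Dc_one pres_class_eq_iff) (rule pres_eq.rel, simp add: dic_rels_def)

lemma dic_y_square: "dic_y n \<otimes>\<^bsub>Dc n\<^esub> dic_y n = dic_x n [^]\<^bsub>Dc n\<^esub> n"
  by (simp add: dic_x_pow_nat dic_y_def Dc_mult_class pres_class_eq_iff)
    (rule pres_eq.rel, simp add: dic_rels_def)

lemma dic_y_conj: "inv\<^bsub>Dc n\<^esub> (dic_y n) \<otimes>\<^bsub>Dc n\<^esub> dic_x n \<otimes>\<^bsub>Dc n\<^esub> dic_y n = inv\<^bsub>Dc n\<^esub> (dic_x n)"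
  by (simp add: dic_x_def dic_y_def Dc_inv_letter Dc_mult_class pres_class_eq_iff)
    (rule pres_eq.rel, simp add: dic_rels_def)

text \<open>
  Left multiplication on the normal forms: \<open>(i, False)\<close> stands for \<open>x\<^sup>i\<close> and \<open>(i, True)\<close> for \<open>x\<^sup>i y\<close>.
  The exponent is kept as an integer, so that a letter and its formal inverse cancel exactly; the
  defining relations hold only modulo \<open>2n\<close>.
\<close>

fun letter_act :: "nat \<Rightarrow> dic_gen \<times> bool \<Rightarrow> int \<times> bool \<Rightarrow> int \<times> bool" where
  "letter_act n (X, True) (i, b) = (i + 1, b)"
| "letter_act n (X, False) (i, b) = (i - 1, b)"
| "letter_act n (Y, True) (i, b) = (if b then int n - i else - i, \<not> b)"
| "letter_act n (Y, False) (i, b) = (if b then - i else int n - i, \<not> b)"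

text \<open>Two pairs denote the same normal form iff their exponents agree modulo \<open>2n\<close>.\<close>

definition nf_cong :: "nat \<Rightarrow> int \<times> bool \<Rightarrow> int \<times> bool \<Rightarrow> bool" where
  "nf_cong n p q \<longleftrightarrow> [fst p = fst q] (mod (2 * int n)) \<and> snd p = snd q"

lemma nf_cong_trans: "nf_cong n p q \<Longrightarrow> nf_cong n q t \<Longrightarrow> nf_cong n p t"
  by (auto simp: nf_cong_def cong_def)

lemma nf_cong_letter_act: "nf_cong n p q \<Longrightarrow> nf_cong n (letter_act n l p) (letter_act n l q)"
  by (cases p; cases q; cases "(n, l, p)" rule: letter_act.cases)
    (auto simp: nf_cong_def cong_add cong_diff cong_minus_minus_iff)

lemma nf_cong_word_act:
  "nf_cong n p q \<Longrightarrow> nf_cong n (foldr (letter_act n) w p) (foldr (letter_act n) w q)"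
  by (induction w) (auto intro: nf_cong_letter_act)

lemma word_act_x_pow: "(letter_act n (X, True) ^^ k) (i, b) = (i + int k, b)"
  by (induction k) auto

lemma nf_cong_rels:
  assumes "(u, v) \<in> dic_rels n"
  shows "nf_cong n (foldr (letter_act n) u p) (foldr (letter_act n) v p)"
  using assms
  by (cases p)
    (auto simp: dic_rels_def nf_cong_def word_act_x_pow cong_iff_dvd_diff)

text \<open>
  Each closure rule of the word congruence preserves equality of the induced maps on normal forms.
  Compatibility with concatenation needs that words act on congruence classes of pairs.
\<close>

lemma nf_cong_pres_eq:
  assumes "pres_eq (dic_rels n) u v"
  shows "nf_cong n (foldr (letter_act n) u p) (foldr (letter_act n) v p)"
  using assms
proof (induction arbitrary: p)
  case (trans u v w)
  show ?case by (rule nf_cong_trans) (rule trans.IH)+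
next
  case (append u u' v v')
  have "nf_cong n (foldr (letter_act n) u (foldr (letter_act n) v p))
      (foldr (letter_act n) u (foldr (letter_act n) v' p))"
    by (rule nf_cong_word_act) (rule append.IH)
  with append.IH(1)[of "foldr (letter_act n) v' p"] show ?case
    by (auto intro: nf_cong_trans)
next
  case (cancel g b)
  show ?case
    by (cases g; cases b; cases p) (auto simp: nf_cong_def)
next
  case (rel u v)
  then show ?case by (rule nf_cong_rels)
qed (auto simp: nf_cong_def cong_sym)

text \<open>Applied to the normal form \<open>x\<^sup>0\<close>, a trivial power \<open>x\<^sup>k\<close> shows that \<open>2n\<close>
  divides \<open>k\<close>.\<close>

lemma dic_x_pow_eq_one_iff: "dic_x n [^]\<^bsub>Dc n\<^esub> (k::int) = \<one>\<^bsub>Dc n\<^esub> \<longleftrightarrow> 2 * int n dvd k"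
proof
  assume "2 * int n dvd k"
  then obtain l where "k = int (2 * n) * l" by (auto simp: dvd_def)
  then show "dic_x n [^]\<^bsub>Dc n\<^esub> k = \<one>\<^bsub>Dc n\<^esub>"
    by (simp only: Dc.int_pow_pow[symmetric] int_pow_int dic_x_closed dic_x_pow_order Dc.int_pow_one)
next
  have nat: "2 * int n dvd int m" if "dic_x n [^]\<^bsub>Dc n\<^esub> m = \<one>\<^bsub>Dc n\<^esub>" for m :: nat
  proof -
    have "pres_eq (dic_rels n) (replicate m (X, True)) []"
      using that by (simp add: dic_x_pow_nat Dc_one pres_class_eq_iff)
    from nf_cong_pres_eq[OF this, of "(0, False)"] show ?thesis
      by (simp add: word_act_x_pow nf_cong_def cong_0_iff)
  qed
  assume k: "dic_x n [^]\<^bsub>Dc n\<^esub> k = \<one>\<^bsub>Dc n\<^esub>"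
  show "2 * int n dvd k"
  proof (cases k rule: int_cases2)
    case (nonneg m)
    then show ?thesis using k nat by (simp add: int_pow_int)
  next
    case (nonpos m)
    then show ?thesis using k nat by (simp add: Dc.int_pow_neg int_pow_int)
  qed
qed

text \<open>
  The two shapes are preserved under left multiplication by each letter; for \<open>y\<^sup>-\<^sup>1\<close> this uses
  \<open>y\<^sup>-\<^sup>1 = y x\<^sup>-\<^sup>n\<close>.
\<close>

lemma Dc_shape:
  assumes "g \<in> carrier (Dc n)"
  shows "\<exists>i::int. g = dic_x n [^]\<^bsub>Dc n\<^esub> i \<or> g = dic_y n \<otimes>\<^bsub>Dc n\<^esub> dic_x n [^]\<^bsub>Dc n\<^esub> i"
proof -
  let ?x = "dic_x n" and ?y = "dic_y n"
  define S where "S = {g. \<exists>i::int. g = ?x [^]\<^bsub>Dc n\<^esub> i \<or> g = ?y \<otimes>\<^bsub>Dc n\<^esub> ?x [^]\<^bsub>Dc n\<^esub> i}"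
  have pow: "?x [^]\<^bsub>Dc n\<^esub> i \<in> S" "?y \<otimes>\<^bsub>Dc n\<^esub> ?x [^]\<^bsub>Dc n\<^esub> i \<in> S" for i :: int
    by (auto simp: S_def)
  have xy: "?x \<otimes>\<^bsub>Dc n\<^esub> ?y = ?y \<otimes>\<^bsub>Dc n\<^esub> inv\<^bsub>Dc n\<^esub> ?x"
    using dic_y_conj[of n] by (simp add: Dc.m_assoc Dc.inv_solve_left')
  have ixy: "inv\<^bsub>Dc n\<^esub> ?x \<otimes>\<^bsub>Dc n\<^esub> ?y = ?y \<otimes>\<^bsub>Dc n\<^esub> ?x"
    using xy by (metis Dc.inv_closed Dc.inv_solve_left Dc.inv_solve_right' Dc.m_assoc Dc.m_closed dic_x_closed dic_y_closed)
  have step: "?x \<otimes>\<^bsub>Dc n\<^esub> ?x [^]\<^bsub>Dc n\<^esub> i = ?x [^]\<^bsub>Dc n\<^esub> (1 + i)"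
    "inv\<^bsub>Dc n\<^esub> ?x \<otimes>\<^bsub>Dc n\<^esub> ?x [^]\<^bsub>Dc n\<^esub> i = ?x [^]\<^bsub>Dc n\<^esub> (i - 1)" for i :: int
    using Dc.int_pow_mult[of "dic_x n" n "- 1" i]
    by (simp_all add: Dc.int_pow_mult Dc.int_pow_neg)
  have x: "?x \<otimes>\<^bsub>Dc n\<^esub> g \<in> S" if "g \<in> S" for g
  proof -
    from that obtain i :: int where "g = ?x [^]\<^bsub>Dc n\<^esub> i \<or> g = ?y \<otimes>\<^bsub>Dc n\<^esub> ?x [^]\<^bsub>Dc n\<^esub> i"
      unfolding S_def by blast
    moreover have "?x \<otimes>\<^bsub>Dc n\<^esub> (?y \<otimes>\<^bsub>Dc n\<^esub> ?x [^]\<^bsub>Dc n\<^esub> i) = ?y \<otimes>\<^bsub>Dc n\<^esub> ?x [^]\<^bsub>Dc n\<^esub> (i - 1)"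
      by (simp add: Dc.m_assoc[symmetric] xy) (simp add: Dc.m_assoc step)
    ultimately show ?thesis using pow step by metis
  qed
  have ix: "inv\<^bsub>Dc n\<^esub> ?x \<otimes>\<^bsub>Dc n\<^esub> g \<in> S" if "g \<in> S" for g
  proof -
    from that obtain i :: int where "g = ?x [^]\<^bsub>Dc n\<^esub> i \<or> g = ?y \<otimes>\<^bsub>Dc n\<^esub> ?x [^]\<^bsub>Dc n\<^esub> i"
      unfolding S_def by blast
    moreover have "inv\<^bsub>Dc n\<^esub> ?x \<otimes>\<^bsub>Dc n\<^esub> (?y \<otimes>\<^bsub>Dc n\<^esub> ?x [^]\<^bsub>Dc n\<^esub> i) = ?y \<otimes>\<^bsub>Dc n\<^esub> ?x [^]\<^bsub>Dc n\<^esub> (1 + i)"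
      by (simp add: Dc.m_assoc[symmetric] ixy) (simp add: Dc.m_assoc step)
    ultimately show ?thesis using pow step by metis
  qed
  have y: "?y \<otimes>\<^bsub>Dc n\<^esub> g \<in> S" if "g \<in> S" for g
  proof -
    from that obtain i :: int where "g = ?x [^]\<^bsub>Dc n\<^esub> i \<or> g = ?y \<otimes>\<^bsub>Dc n\<^esub> ?x [^]\<^bsub>Dc n\<^esub> i"
      unfolding S_def by blast
    moreover have "?y \<otimes>\<^bsub>Dc n\<^esub> (?y \<otimes>\<^bsub>Dc n\<^esub> ?x [^]\<^bsub>Dc n\<^esub> i) = ?x [^]\<^bsub>Dc n\<^esub> (int n + i)"
      by (simp add: Dc.int_pow_mult Dc.m_assoc[symmetric] dic_y_square int_pow_int)
    ultimately show ?thesis using pow by metis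
  qed
  have iy_eq: "inv\<^bsub>Dc n\<^esub> ?y = ?y \<otimes>\<^bsub>Dc n\<^esub> ?x [^]\<^bsub>Dc n\<^esub> (- int n)"
  proof (rule Dc.inv_equality[OF Dc.inv_comm])
    show "?y \<otimes>\<^bsub>Dc n\<^esub> (?y \<otimes>\<^bsub>Dc n\<^esub> ?x [^]\<^bsub>Dc n\<^esub> (- int n)) = \<one>\<^bsub>Dc n\<^esub>"
      by (simp add: Dc.m_assoc[symmetric] dic_y_square Dc.int_pow_neg int_pow_int)
  qed simp_all
  have iy: "inv\<^bsub>Dc n\<^esub> ?y \<otimes>\<^bsub>Dc n\<^esub> g \<in> S" if "g \<in> S" for g
  proof -
    from that obtain i :: int where "g = ?x [^]\<^bsub>Dc n\<^esub> i \<or> g = ?y \<otimes>\<^bsub>Dc n\<^esub> ?x [^]\<^bsub>Dc n\<^esub> i"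
      unfolding S_def by blast
    moreover have "inv\<^bsub>Dc n\<^esub> ?y \<otimes>\<^bsub>Dc n\<^esub> ?x [^]\<^bsub>Dc n\<^esub> i = ?y \<otimes>\<^bsub>Dc n\<^esub> ?x [^]\<^bsub>Dc n\<^esub> (- int n + i)"
      unfolding iy_eq by (simp only: Dc.m_assoc Dc.int_pow_mult Dc.int_pow_closed dic_x_closed dic_y_closed)
    moreover have "inv\<^bsub>Dc n\<^esub> ?y \<otimes>\<^bsub>Dc n\<^esub> (?y \<otimes>\<^bsub>Dc n\<^esub> ?x [^]\<^bsub>Dc n\<^esub> i) = ?x [^]\<^bsub>Dc n\<^esub> i"
      by (simp add: Dc.m_assoc[symmetric])
    ultimately show ?thesis using pow by metis
  qed
  have "pres_class (dic_rels n) w \<in> S" for w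
  proof (induction w)
    case Nil
    show ?case using pow(1)[of 0] by (simp add: Dc_one)
  next
    case (Cons l w)
    obtain g b where l: "l = (g, b)" by fastforce
    have "pres_class (dic_rels n) (l # w) =
        pres_class (dic_rels n) [l] \<otimes>\<^bsub>Dc n\<^esub> pres_class (dic_rels n) w"
      by (simp add: Dc_mult_class)
    moreover have "pres_class (dic_rels n) [l] \<in> {?x, inv\<^bsub>Dc n\<^esub> ?x, ?y, inv\<^bsub>Dc n\<^esub> ?y}"
      unfolding l dic_x_def dic_y_def Dc_inv_letter by (cases g; cases b) simp_all
    ultimately show ?case
      using x[OF Cons.IH] ix[OF Cons.IH] y[OF Cons.IH] iy[OF Cons.IH]
      by (elim insertE emptyE) simp_all
  qed
  moreover obtain w where "g = pres_class (dic_rels n) w"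
    using assms by (auto simp: Dc_def presented_group_def)
  ultimately show ?thesis unfolding S_def by blast
qed

section \<open>Twisted conjugacy in the dicyclic group\<close>

theorem proposition3p9:
  fixes n :: nat and r s :: int
    and \<phi> :: "dic_gen word set \<Rightarrow> dic_gen word set"
  assumes "n > 2"
    and "r \<in> Units (Z2 n)"
    and "s \<in> carrier (Z2 n)"
    and "\<phi> \<in> iso (Dc n) (Dc n)"
    and "\<phi> (dic_x n) = dic_x n [^]\<^bsub>Dc n\<^esub> r"
    and "\<phi> (dic_y n) = dic_y n \<otimes>\<^bsub>Dc n\<^esub> dic_x n [^]\<^bsub>Dc n\<^esub> s"
  shows
    "(s \<notin> add_gen n (\<one>\<^bsub>Z2 n\<^esub> \<ominus>\<^bsub>Z2 n\<^esub> r) \<longrightarrow>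
        twisted_orbits (Dc n) \<phi> (fixed_points (Dc n) \<phi>)
          = {{dic_x n [^]\<^bsub>Dc n\<^esub> j} | j.
               j \<in> add_gen n (\<one>\<^bsub>Z2 n\<^esub> \<ominus>\<^bsub>Z2 n\<^esub> r)
                   \<union> (s <+\<^bsub>Z2 n\<^esub> add_gen n (r \<ominus>\<^bsub>Z2 n\<^esub> \<one>\<^bsub>Z2 n\<^esub>))} \<and>
        twisted_orbits (Dc n) \<phi> (fixed_points (Dc n) \<phi>)
          = {{dic_x n [^]\<^bsub>Dc n\<^esub> j} | j.
               j \<in> carrier (Z2 n) \<and> dic_x n [^]\<^bsub>Dc n\<^esub> j \<in> twisted_Q (Dc n) \<phi>}) \<and>
     (s \<in> add_gen n (\<one>\<^bsub>Z2 n\<^esub> \<ominus>\<^bsub>Z2 n\<^esub> r) \<longrightarrow>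
        twisted_orbits (Dc n) \<phi> (fixed_points (Dc n) \<phi>)
          = {{dic_x n [^]\<^bsub>Dc n\<^esub> j, dic_x n [^]\<^bsub>Dc n\<^esub> (- j)} | j.
               j \<in> add_gen n (\<one>\<^bsub>Z2 n\<^esub> \<ominus>\<^bsub>Z2 n\<^esub> r)
                   \<union> (s <+\<^bsub>Z2 n\<^esub> add_gen n (r \<ominus>\<^bsub>Z2 n\<^esub> \<one>\<^bsub>Z2 n\<^esub>))} \<and>
        twisted_orbits (Dc n) \<phi> (fixed_points (Dc n) \<phi>)
          = {{dic_x n [^]\<^bsub>Dc n\<^esub> j, dic_x n [^]\<^bsub>Dc n\<^esub> (- j)} | j.
               j \<in> carrier (Z2 n) \<and> dic_x n [^]\<^bsub>Dc n\<^esub> j \<in> twisted_Q (Dc n) \<phi>}) \<and>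
     twisted_orbits (Dc n) \<phi> (carrier (Dc n)) = {twisted_Q (Dc n) \<phi>}"
proof -
  have hom: "\<phi> \<in> hom (Dc n) (Dc n)"
    using assms(4) by (simp add: iso_def)
  have pos: "n > 0" using assms(1) by simp
  interpret dicyclic_twist "Dc n" \<phi> "dic_x n" "dic_y n" n r s
    by unfold_locales
      (use assms hom pos dic_x_pow_eq_one_iff dic_y_conj Dc_shape in simp_all)
  have r: "r \<in> carrier (Z2 n)" using assms(2) by (simp add: Units_def)
  have one: "\<one>\<^bsub>Z2 n\<^esub> \<in> carrier (Z2 n)" "\<one>\<^bsub>Z2 n\<^esub> = 1"
    using assms(1) by (simp_all add: residue_ring_def)
  have gen: "add_gen n (\<one>\<^bsub>Z2 n\<^esub> \<ominus>\<^bsub>Z2 n\<^esub> r) = range (\<lambda>i. (i * (1 - r)) mod (2 * int n))"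
    "add_gen n (r \<ominus>\<^bsub>Z2 n\<^esub> \<one>\<^bsub>Z2 n\<^esub>) = range (\<lambda>i. (i * (r - 1)) mod (2 * int n))"
    using r one pos by (simp_all only: residue_ring_minus add_gen_mod)
  have "s <+\<^bsub>Z2 n\<^esub> add_gen n (r \<ominus>\<^bsub>Z2 n\<^esub> \<one>\<^bsub>Z2 n\<^esub>) = range (\<lambda>i. (s + i * (r - 1)) mod (2 * int n))"
    unfolding gen(2) a_l_coset_def l_coset_def by (auto simp: residue_ring_def mod_simps)
  then have J: "add_gen n (\<one>\<^bsub>Z2 n\<^esub> \<ominus>\<^bsub>Z2 n\<^esub> r) \<union>
      (s <+\<^bsub>Z2 n\<^esub> add_gen n (r \<ominus>\<^bsub>Z2 n\<^esub> \<one>\<^bsub>Z2 n\<^esub>)) = exponents"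
    unfolding exponents_def gen(1) by simp
  have dichotomy: "s \<in> add_gen n (\<one>\<^bsub>Z2 n\<^esub> \<ominus>\<^bsub>Z2 n\<^esub> r) \<longleftrightarrow>
      (\<exists>i::int. dic_y n \<otimes>\<^bsub>Dc n\<^esub> dic_x n [^]\<^bsub>Dc n\<^esub> i \<in> fixed_points (Dc n) \<phi>)"
    unfolding gen(1) using multiple_of_one_minus_r_iff assms(3) by simp
  note orbits_exponents = twisted_orbits_fixed_points[OF twisted_Q_eq[symmetric]]
  note orbits_Q = twisted_orbits_fixed_points[OF x_pow_image_carrier]
  show ?thesis
    unfolding J dichotomy
  proof (intro conjI impI, goal_cases)
    case 1 then show ?case using orbits_exponents by simp
  next
    case 2 then show ?case using orbits_Q by simp
  next
    case 3 then show ?case using orbits_exponents by simp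
  next
    case 4 then show ?case using orbits_Q by simp
  next
    case 5 show ?case by (rule twisted_orbits_carrier[OF Dc.is_group hom])
  qed
qed

end
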